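(* Let $Y$ be a convex subset of $\mathbb C$ with a marked point $a\in Y$ (with the usual metric) and let $\tilde r$ be a normalizing sequence. The following statements hold for every pretangent space $\Omega_{a,\tilde r}^Y$ to $Y$ at $a$. (i) If the space $\Omega_{a,\tilde r}^Y$ is tangent, then $\Omega_{a,\tilde r}^Y$ and $Conv_a(Y)$ are isometric. (ii) If $\Omega_{a,\tilde r}^Y$ is pretangent, then $\Omega_{a,\tilde r}^Y$ lies in some tangent space $\Omega_{a,\tilde r'}^Y$.
   Context: Pretangent and tangent spaces. Let $(X,d)$ be a metric space with a marked point $a\in X$ (here the metric space is $Y$). A normalizing sequence is a sequence $\tilde r=\{r_n\}_{n\in\mathbb N}$ of positive reals with $r_n\to0$. $\tilde X$ is the set of all sequences of points of $X$. Sequences $\tilde x=\{x_n\},\tilde y=\{y_n\}\in\tilde X$ are mutually stable w.r.t. $\tilde r$ if the finite limit $\tilde d_{\tilde r}(\tilde x,\tilde y)=\tilde d(\tilde x,\tilde y):=\lim_{n\to\infty} d(x_n,y_n)/r_n$ exists. A family $\tilde F\subseteq\tilde X$ is self-stable (w.r.t. $\tilde r$) if every two of its elements are mutually stable; it is maximal self-stable if it is self-stable and every $\tilde z\in\tilde X$ either belongs to $\tilde F$ or is not mutually stable with some $\tilde x\in\tilde F$. Write $\tilde a=(a,a,\dots)$. $\tilde X_{a,\tilde r}$ denotes a maximal self-stable (w.r.t. $\tilde r$) family containing $\tilde a$; $\tilde d$ is a pseudometric on it. The metric identification of $(\tilde X_{a,\tilde r},\tilde d)$ (the quotient by $\tilde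 d(\tilde x,\tilde y)=0$ with the induced metric) is denoted $\Omega_{a,\tilde r}=\Omega^X_{a,\tilde r}$ and called a pretangent space to $X$ at $a$ w.r.t. $\tilde r$ (it depends on the choice of $\tilde X_{a,\tilde r}$). An isometry is a distance-preserving surjection. For a subsequence $\tilde r'=\{r_{n_k}\}_k$ of $\tilde r$ ($n_k$ strictly increasing) and $\tilde x\in\tilde X$ put $\tilde x'=\{x_{n_k}\}_k$. There is a maximal self-stable (w.r.t. $\tilde r'$) family $\tilde X_{a,\tilde r'}\supseteq\{\tilde x':\tilde x\in\tilde X_{a,\tilde r}\}$, and $\tilde x\mapsto\tilde x'$ induces a distance-preserving map $em':\Omega_{a,\tilde r}\to\Omega_{a,\tilde r'}$, where $\Omega_{a,\tilde r'}$ is the metric identification of $\tilde X_{a,\tilde r'}$. The pretangent space $\Omega_{a,\tilde r}$ is tangent if $em'$ is an isometry for every subsequence $\tilde r'$ (this does not depend on the choice of $\tilde X_{a,\tilde r'}$). The pretangent space $\Omega_{a,\tilde r}$ (with corresponding family $\tilde X_{a,\tilde r}$) lies in a tangent space $\Omega_{a,\tilde r'}$ if for some subsequence $\tilde r'$ of $\tilde r$ there is a maximal self-stable (w.r.t. $\tilde r'$) family $\tilde X_{a,\tilde r'}\supseteq\{\tilde x':\tilde x\in\tilde X_{a,\tilde r}\}$ whose metric identification $\Omega_{a,\tilde r'}$ is tangent. Cones. A set $A\subseteq\mathbb C$ is a cone with vertex $a$ if the ray $l_a(b)=\{a+t(b-a):t\in[0,\infty)\}$ lies in $A$ for every $b\in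 A$. $Conv_a(Y)$ is the intersection of all closed convex cones $A\supseteq Y$ with vertex $a$. *)

theory Defs
  imports "HOL-Analysis.Analysis"
begin

text \<open>
  A metric space is rendered as a subset \<open>X\<close> of a type of class \<open>metric_space\<close> with the
  restricted distance; sequences of points of \<open>X\<close> are the elements of \<open>UNIV \<rightarrow> X\<close>.
\<close>

definition normalizing_seq :: "(nat \<Rightarrow> real) \<Rightarrow> bool" where
  "normalizing_seq r \<longleftrightarrow> (\<forall>n. r n > 0) \<and> r \<longlonglongrightarrow> 0"

definition mutually_stable ::
    "(nat \<Rightarrow> real) \<Rightarrow> (nat \<Rightarrow> 'a::metric_space) \<Rightarrow> (nat \<Rightarrow> 'a) \<Rightarrow> bool" where
  "mutually_stable r x y \<longleftrightarrow> convergent (\<lambda>n. dist (x n) (y n) / r n)"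

definition seq_dist ::
    "(nat \<Rightarrow> real) \<Rightarrow> (nat \<Rightarrow> 'a::metric_space) \<Rightarrow> (nat \<Rightarrow> 'a) \<Rightarrow> real" where
  "seq_dist r x y = lim (\<lambda>n. dist (x n) (y n) / r n)"

definition self_stable ::
    "'a::metric_space set \<Rightarrow> (nat \<Rightarrow> real) \<Rightarrow> (nat \<Rightarrow> 'a) set \<Rightarrow> bool" where
  "self_stable X r F \<longleftrightarrow> F \<subseteq> (UNIV \<rightarrow> X) \<and> (\<forall>x\<in>F. \<forall>y\<in>F. mutually_stable r x y)"

definition maximal_self_stable ::
    "'a::metric_space set \<Rightarrow> (nat \<Rightarrow> real) \<Rightarrow> (nat \<Rightarrow> 'a) set \<Rightarrow> bool" where
  "maximal_self_stable X r F \<longleftrightarrow> self_stable X r F \<and>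
     (\<forall>z \<in> UNIV \<rightarrow> X. z \<in> F \<or> (\<exists>x\<in>F. \<not> mutually_stable r z x))"

definition pretangent_family ::
    "'a::metric_space set \<Rightarrow> 'a \<Rightarrow> (nat \<Rightarrow> real) \<Rightarrow> (nat \<Rightarrow> 'a) set \<Rightarrow> bool" where
  "pretangent_family X a r F \<longleftrightarrow> maximal_self_stable X r F \<and> (\<lambda>n. a) \<in> F"

text \<open>
  The pretangent space determined by a family \<open>F\<close> is its metric identification: the set
  \<open>pretangent_space r F\<close> of equivalence classes with the metric \<open>pretangent_dist r\<close>.
\<close>

definition zero_dist_rel ::
    "(nat \<Rightarrow> real) \<Rightarrow> (nat \<Rightarrow> 'a::metric_space) set \<Rightarrow> ((nat \<Rightarrow> 'a) \<times> (nat \<Rightarrow> 'a)) set" where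
  "zero_dist_rel r F = {(x, y). x \<in> F \<and> y \<in> F \<and> seq_dist r x y = 0}"

definition pretangent_space ::
    "(nat \<Rightarrow> real) \<Rightarrow> (nat \<Rightarrow> 'a::metric_space) set \<Rightarrow> (nat \<Rightarrow> 'a) set set" where
  "pretangent_space r F = F // zero_dist_rel r F"

definition pretangent_dist ::
    "(nat \<Rightarrow> real) \<Rightarrow> (nat \<Rightarrow> 'a::metric_space) set \<Rightarrow> (nat \<Rightarrow> 'a) set \<Rightarrow> real" where
  "pretangent_dist r A B = the_elem {seq_dist r x y | x y. x \<in> A \<and> y \<in> B}"

definition is_isometry ::
    "'a set \<Rightarrow> ('a \<Rightarrow> 'a \<Rightarrow> real) \<Rightarrow> 'b set \<Rightarrow> ('b \<Rightarrow> 'b \<Rightarrow> real) \<Rightarrow> ('a \<Rightarrow> 'b) \<Rightarrow> bool" where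
  "is_isometry M d N e f \<longleftrightarrow> f ` M = N \<and> (\<forall>x\<in>M. \<forall>y\<in>M. e (f x) (f y) = d x y)"

definition isometric_spaces ::
    "'a set \<Rightarrow> ('a \<Rightarrow> 'a \<Rightarrow> real) \<Rightarrow> 'b set \<Rightarrow> ('b \<Rightarrow> 'b \<Rightarrow> real) \<Rightarrow> bool" where
  "isometric_spaces M d N e \<longleftrightarrow> (\<exists>f. is_isometry M d N e f)"

text \<open>
  A subsequence is given by a strictly increasing \<open>s\<close>. The map \<open>subseq_map r s F'\<close> sends the class
  of \<open>x\<close> to the class of \<open>x \<circ> s\<close> in the metric identification of \<open>F'\<close> with respect to \<open>r \<circ> s\<close>.
\<close>

definition subseq_family :: "(nat \<Rightarrow> nat) \<Rightarrow> (nat \<Rightarrow> 'a) set \<Rightarrow> (nat \<Rightarrow> 'a) set" where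
  "subseq_family s F = (\<lambda>x. x \<circ> s) ` F"

definition subseq_map ::
    "(nat \<Rightarrow> real) \<Rightarrow> (nat \<Rightarrow> nat) \<Rightarrow> (nat \<Rightarrow> 'a::metric_space) set \<Rightarrow>
      (nat \<Rightarrow> 'a) set \<Rightarrow> (nat \<Rightarrow> 'a) set" where
  "subseq_map r s F' A = zero_dist_rel (r \<circ> s) F' `` subseq_family s A"

text \<open>
  Tangency does not depend on the choice of the family \<open>F'\<close>, and such a family always exists
  (\<open>ex_pretangent_family_subseq\<close> below), so quantifying over all choices is harmless.
\<close>

definition tangent ::
    "'a::metric_space set \<Rightarrow> 'a \<Rightarrow> (nat \<Rightarrow> real) \<Rightarrow> (nat \<Rightarrow> 'a) set \<Rightarrow> bool" where
  "tangent X a r F \<longleftrightarrow> pretangent_family X a r F \<and>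
     (\<forall>s F'. strict_mono s \<and> pretangent_family X a (r \<circ> s) F' \<and> subseq_family s F \<subseteq> F' \<longrightarrow>
        is_isometry (pretangent_space r F) (pretangent_dist r)
          (pretangent_space (r \<circ> s) F') (pretangent_dist (r \<circ> s)) (subseq_map r s F'))"

definition lies_in_tangent ::
    "'a::metric_space set \<Rightarrow> 'a \<Rightarrow> (nat \<Rightarrow> real) \<Rightarrow> (nat \<Rightarrow> 'a) set \<Rightarrow> bool" where
  "lies_in_tangent X a r F \<longleftrightarrow>
     (\<exists>s F'. strict_mono s \<and> pretangent_family X a (r \<circ> s) F' \<and> subseq_family s F \<subseteq> F' \<and>
        tangent X a (r \<circ> s) F')"

definition ray :: "complex \<Rightarrow> complex \<Rightarrow> complex set" where
  "ray a b = {a + of_real t * (b - a) | t. t \<ge> 0}"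

definition cone_with_vertex :: "complex \<Rightarrow> complex set \<Rightarrow> bool" where
  "cone_with_vertex a A \<longleftrightarrow> (\<forall>b\<in>A. ray a b \<subseteq> A)"

definition Conv :: "complex \<Rightarrow> complex set \<Rightarrow> complex set" where
  "Conv a Y = \<Inter>{A. closed A \<and> convex A \<and> cone_with_vertex a A \<and> Y \<subseteq> A}"

lemma seq_dist_commute: "seq_dist r x y = seq_dist r y x"
  by (simp add: seq_dist_def dist_commute)

lemma seq_dist_refl: "seq_dist r x x = 0"
  by (simp add: seq_dist_def)

lemma seq_dist_triangle:
  assumes "\<And>n. r n > 0" "mutually_stable r x y" "mutually_stable r y z" "mutually_stable r x z"
  shows "seq_dist r x z \<le> seq_dist r x y + seq_dist r y z"
proof -
  have L: "(\<lambda>n. dist (u n) (v n) / r n) \<longlonglongrightarrow> seq_dist r u v" if "mutually_stable r u v"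
    for u v :: "nat \<Rightarrow> 'a"
    using that by (simp add: mutually_stable_def seq_dist_def convergent_LIMSEQ_iff)
  have "dist (x n) (z n) / r n \<le> dist (x n) (y n) / r n + dist (y n) (z n) / r n" for n
    using assms(1)[of n] dist_triangle[of "x n" "z n" "y n"]
    by (simp add: add_divide_distrib[symmetric] divide_right_mono)
  then show ?thesis
    using LIMSEQ_le[OF L[OF assms(4)] tendsto_add[OF L[OF assms(2)] L[OF assms(3)]]] by blast
qed

lemma pretangent_dist_class:
  assumes r: "\<And>n. r n > 0" and F: "self_stable X r F" and x: "x \<in> F" and y: "y \<in> F"
  shows "pretangent_dist r (zero_dist_rel r F `` {x}) (zero_dist_rel r F `` {y}) = seq_dist r x y"
proof -
  have tri: "seq_dist r u w \<le> seq_dist r u v + seq_dist r v w"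
    if "u \<in> F" "v \<in> F" "w \<in> F" for u v w
    using that F by (intro seq_dist_triangle r) (auto simp: self_stable_def)
  have "seq_dist r x' y' = seq_dist r x y"
    if "x' \<in> F" "y' \<in> F" "seq_dist r x x' = 0" "seq_dist r y y' = 0" for x' y'
  proof -
    have "seq_dist r x' x = 0" "seq_dist r y' y = 0"
      using that seq_dist_commute by metis+
    then show ?thesis
      using tri[of x' x y'] tri[of x y y'] tri[of x x' y] tri[of x' y' y] that x y by linarith
  qed
  then have "seq_dist r u v = seq_dist r x y"
    if "u \<in> zero_dist_rel r F `` {x}" "v \<in> zero_dist_rel r F `` {y}" for u v
    using that by (simp add: zero_dist_rel_def)
  moreover have "x \<in> zero_dist_rel r F `` {x}" "y \<in> zero_dist_rel r F `` {y}"
    using x y by (simp_all add: zero_dist_rel_def seq_dist_refl)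
  ultimately have "{seq_dist r u v | u v. u \<in> zero_dist_rel r F `` {x} \<and> v \<in> zero_dist_rel r F `` {y}}
      = {seq_dist r x y}"
    by blast
  then show ?thesis
    by (simp add: pretangent_dist_def)
qed

lemma mutually_stable_commute: "mutually_stable r x y \<longleftrightarrow> mutually_stable r y x"
  by (simp add: mutually_stable_def dist_commute)

lemma ex_maximal_self_stable:
  assumes "self_stable X r G"
  shows "\<exists>F. maximal_self_stable X r F \<and> G \<subseteq> F"
proof -
  let ?S = "{F. self_stable X r F \<and> G \<subseteq> F}"
  have "\<exists>M\<in>?S. \<forall>F\<in>?S. M \<subseteq> F \<longrightarrow> F = M"
  proof (rule subset_Zorn_nonempty)
    show "?S \<noteq> {}" using assms by auto
  next
    fix C assume C: "C \<noteq> {}" "subset.chain ?S C"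
    have "mutually_stable r x y" if "x \<in> A" "A \<in> C" "y \<in> B" "B \<in> C" for x y A B
    proof -
      have "A \<subseteq> B \<or> B \<subseteq> A" "self_stable X r A" "self_stable X r B"
        using C that unfolding subset_chain_def by auto
      then show ?thesis using that by (auto simp: self_stable_def)
    qed
    then have "\<forall>x\<in>\<Union>C. \<forall>y\<in>\<Union>C. mutually_stable r x y"
      by (meson UnionE)
    moreover have "A \<subseteq> UNIV \<rightarrow> X" "G \<subseteq> A" if "A \<in> C" for A
      using C(2) that by (auto simp only: subset_chain_def self_stable_def)
    then have "\<Union>C \<subseteq> UNIV \<rightarrow> X" "G \<subseteq> \<Union>C"
      using C(1) by (simp_all only: Union_least) blast
    ultimately show "\<Union>C \<in> ?S"
      by (simp only: self_stable_def mem_Collect_eq simp_thms)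
  qed
  then obtain M where MS: "M \<in> ?S" and mxS: "\<forall>F\<in>?S. M \<subseteq> F \<longrightarrow> F = M"
    by (rule bexE)
  have M: "self_stable X r M" "G \<subseteq> M"
    using MS by simp_all
  have mx: "F = M" if "self_stable X r F" "M \<subseteq> F" for F
    using mxS that M(2) by simp
  have "z \<in> M \<or> (\<exists>x\<in>M. \<not> mutually_stable r z x)" if z: "z \<in> UNIV \<rightarrow> X" for z
  proof (rule ccontr)
    assume neg: "\<not> ?thesis"
    have "mutually_stable r z z"
      by (simp add: mutually_stable_def convergent_const)
    moreover have "mutually_stable r z x" "mutually_stable r x z" if "x \<in> M" for x
      using neg that mutually_stable_commute by blast+
    ultimately have "self_stable X r (insert z M)"
      using M(1) z by (simp add: self_stable_def)
    then have "insert z M = M" using mx by (simp add: subset_insertI)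
    then show False using neg by blast
  qed
  then show ?thesis using M unfolding maximal_self_stable_def by blast
qed

lemma ex_pretangent_family_subseq:
  assumes "pretangent_family X a r F" "strict_mono s"
  shows "\<exists>F'. pretangent_family X a (r \<circ> s) F' \<and> subseq_family s F \<subseteq> F'"
proof -
  have F: "self_stable X r F" and a: "(\<lambda>n. a) \<in> F"
    using assms(1) by (auto simp: pretangent_family_def maximal_self_stable_def)
  have "mutually_stable (r \<circ> s) (x \<circ> s) (y \<circ> s)" if "mutually_stable r x y" for x y :: "nat \<Rightarrow> 'a"
    using convergent_subseq_convergent[OF that[unfolded mutually_stable_def] assms(2)]
    by (simp add: mutually_stable_def o_def)
  then have "self_stable X (r \<circ> s) (subseq_family s F)"
    using F by (auto simp: self_stable_def subseq_family_def Pi_iff subset_iff)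
  then obtain F' where "maximal_self_stable X (r \<circ> s) F'" "subseq_family s F \<subseteq> F'"
    using ex_maximal_self_stable by blast
  moreover have "(\<lambda>n. a) \<in> subseq_family s F"
    using a by (force simp: subseq_family_def o_def)
  ultimately show ?thesis by (auto simp: pretangent_family_def)
qed

lemma subseq_map_class:
  assumes r: "\<And>n. r n > 0" and F: "self_stable X r F" and s: "strict_mono s"
    and F': "self_stable X (r \<circ> s) F'" "subseq_family s F \<subseteq> F'" and x: "x \<in> F"
  shows "subseq_map r s F' (zero_dist_rel r F `` {x}) = zero_dist_rel (r \<circ> s) F' `` {x \<circ> s}"
proof -
  have sub: "seq_dist (r \<circ> s) (u \<circ> s) (v \<circ> s) = seq_dist r u v" if "u \<in> F" "v \<in> F" for u v
  proof -
    have "mutually_stable r u v" using F that by (auto simp: self_stable_def)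
    then have "(\<lambda>n. dist (u n) (v n) / r n) \<longlonglongrightarrow> seq_dist r u v"
      by (simp add: mutually_stable_def seq_dist_def convergent_LIMSEQ_iff)
    from LIMSEQ_subseq_LIMSEQ[OF this s] show ?thesis
      by (simp add: seq_dist_def o_def limI)
  qed
  have tri: "seq_dist (r \<circ> s) u w \<le> seq_dist (r \<circ> s) u v + seq_dist (r \<circ> s) v w"
    if "u \<in> F'" "v \<in> F'" "w \<in> F'" for u v w
    using that F'(1) r by (intro seq_dist_triangle) (auto simp: self_stable_def)
  have nonneg: "0 \<le> seq_dist (r \<circ> s) u v" if "u \<in> F'" "v \<in> F'" for u v
    using tri[of u v u] that seq_dist_refl[of "r \<circ> s" u] seq_dist_commute[of "r \<circ> s" u v] by simp
  have mem: "u \<circ> s \<in> F'" if "u \<in> F" for u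
    using F'(2) that by (auto simp: subseq_family_def)
  have "seq_dist (r \<circ> s) (x \<circ> s) w = 0"
    if "u \<in> F" "seq_dist r x u = 0" "w \<in> F'" "seq_dist (r \<circ> s) (u \<circ> s) w = 0" for u w
    using tri[of "x \<circ> s" "u \<circ> s" w] nonneg[of "x \<circ> s" w] sub[of x u] that x mem by simp
  then have "subseq_map r s F' (zero_dist_rel r F `` {x}) \<subseteq> zero_dist_rel (r \<circ> s) F' `` {x \<circ> s}"
    using x mem by (auto simp: subseq_map_def subseq_family_def zero_dist_rel_def)
  moreover have "x \<circ> s \<in> subseq_family s (zero_dist_rel r F `` {x})"
    using x seq_dist_refl[of r x] by (simp add: subseq_family_def zero_dist_rel_def)
  ultimately show ?thesis
    unfolding subseq_map_def by blast
qed

end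

theory Submission
  imports Defs
begin

text \<open>
  Magnify \<open>Y\<close> about \<open>a\<close> by the factor \<open>1 / r n\<close>. Under this map a sequence \<open>x\<close> of points of \<open>Y\<close>
  becomes its blow-up \<open>a + (x n - a) / r n\<close>, and the quotients \<open>dist (x n) (y n) / r n\<close> become
  ordinary distances of blow-ups. The magnified copies of \<open>Y\<close> lie in the closed cone \<open>Conv a Y\<close>,
  and since \<open>Y\<close> is convex they fill it in the limit: every point of the cone is the limit of
  some blow-up (\<open>Conv_point_is_blowup_limit\<close>).

  Let \<open>B\<close> be the family of sequences whose blow-ups converge. Its metric identification is the
  cone itself, the isometry being the limit of the blow-up. Moreover \<open>B\<close> is maximal
  self-stable, because a sequence stable with all of \<open>B\<close> has a convergent blow-up: if \<open>p\<close> and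
  \<open>q\<close> are two cluster points of it, they have the same distance to every point of the cone, in
  particular to \<open>p\<close>, which gives \<open>p = q\<close>
  (\<open>blowup_convergent_if_stable_with_all_limits\<close>). The argument still works when stability is
  known only along a subsequence, so \<open>B\<close> is even tangent.

  An arbitrary maximal self-stable family \<open>F\<close> need not consist of sequences with convergent
  blow-ups: rotating or reflecting the blow-ups by isometries that vary with \<open>n\<close> leaves all
  distances unchanged. An isometry of the plane is, however, determined by its values at finitely
  many points, so one subsequence makes all blow-ups of members of \<open>F\<close> converge
  simultaneously (\<open>common_convergent_subsequence\<close>). Along this subsequence \<open>F\<close> is mapped into
  the tangent family \<open>B\<close>, so \<open>F\<close> lies in a tangent space. If \<open>F\<close> is itself tangent, the map from the
  pretangent space of \<open>F\<close> to that of \<open>B\<close> is an isometry, and the latter is isometric to the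
  cone.
\<close>

section \<open>Sequences with convergent mutual distances\<close>

lemma bounded_convergent_if_unique_cluster_point:
  fixes x :: "nat \<Rightarrow> 'a::heine_borel"
  assumes bdd: "bounded (range x)"
    and unique: "\<And>s t p q. strict_mono s \<Longrightarrow> strict_mono t \<Longrightarrow>
                   (x \<circ> s) \<longlonglongrightarrow> p \<Longrightarrow> (x \<circ> t) \<longlonglongrightarrow> q \<Longrightarrow> p = q"
  shows "convergent x"
proof -
  obtain p s where s: "strict_mono s" "(x \<circ> s) \<longlonglongrightarrow> p"
    using bounded_imp_convergent_subsequence[OF bdd] by blast
  have "x \<longlonglongrightarrow> p"
  proof (rule ccontr)
    assume "\<not> x \<longlonglongrightarrow> p"
    then obtain e where e: "e > 0" and "\<forall>N. \<exists>n\<ge>N. dist (x n) p \<ge> e"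
      by (auto simp: lim_sequentially not_less)
    then have "infinite {n. dist (x n) p \<ge> e}"
      by (simp add: infinite_nat_iff_unbounded_le)
    then obtain t :: "nat \<Rightarrow> nat" where t: "strict_mono t" "\<And>n. dist (x (t n)) p \<ge> e"
      by (metis (mono_tags, lifting) infinite_enumerate mem_Collect_eq)
    have "bounded (range (x \<circ> t))"
      using bdd by (rule bounded_subset) auto
    then obtain q u where u: "strict_mono u" "((x \<circ> t) \<circ> u) \<longlonglongrightarrow> q"
      using bounded_imp_convergent_subsequence by blast
    then have "p = q"
      using unique[OF s(1) strict_mono_o[OF t(1) u(1)] s(2)] by (simp add: o_assoc)
    then have "\<forall>\<^sub>F n in sequentially. dist (x (t (u n))) p < e"
      using tendstoD[OF u(2) e] by simp
    then show False
      using t(2) by (auto simp: eventually_sequentially not_less[symmetric])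
  qed
  then show ?thesis by (rule convergentI)
qed

lemma LIMSEQ_common_subseq_limits_equal:
  fixes f :: "nat \<Rightarrow> 'a::t2_space"
  assumes "convergent f" "strict_mono s" "strict_mono t"
    and "(f \<circ> s) \<longlonglongrightarrow> p" "(f \<circ> t) \<longlonglongrightarrow> q"
  shows "p = q"
  using assms by (metis LIMSEQ_subseq_LIMSEQ LIMSEQ_unique convergent_def)

text \<open>
  Pass to a subsequence \<open>s\<close> for which the limits of those members of \<open>Z\<close> that converge span a
  space of the largest possible dimension. By maximality every cluster point along \<open>s\<close> of every
  member of \<open>Z\<close> lies in this span. On the other hand, two cluster points of the same member
  have equal norms and equal distances to the spanning limits, so their difference is
  orthogonal to the span. Hence they coincide.
\<close>
lemma common_convergent_subsequence:
  fixes Z :: "(nat \<Rightarrow> 'a::euclidean_space) set"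
  assumes norm_conv: "\<And>z. z \<in> Z \<Longrightarrow> convergent (\<lambda>n. norm (z n))"
    and dist_conv: "\<And>z w. z \<in> Z \<Longrightarrow> w \<in> Z \<Longrightarrow> convergent (\<lambda>n. dist (z n) (w n))"
  obtains s :: "nat \<Rightarrow> nat" where "strict_mono s" "\<And>z. z \<in> Z \<Longrightarrow> convergent (z \<circ> s)"
proof -
  define L where "L s = {p. \<exists>z\<in>Z. (z \<circ> s) \<longlonglongrightarrow> p}" for s :: "nat \<Rightarrow> nat"
  have "\<forall>s. strict_mono s \<longrightarrow> dim (L s) < Suc DIM('a)"
    by (simp add: dim_subset_UNIV less_Suc_eq_le)
  then obtain s where s: "strict_mono s"
    and s_max: "\<And>t. strict_mono t \<Longrightarrow> dim (L t) \<le> dim (L s)"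
    using ex_has_greatest_nat[of strict_mono id "\<lambda>s. dim (L s)" "Suc DIM('a)"]
      strict_mono_id by blast
  have in_span: "p \<in> span (L s)"
    if z: "z \<in> Z" and t: "strict_mono t" and p: "((z \<circ> s) \<circ> t) \<longlonglongrightarrow> p" for z t p
  proof -
    have "L s \<subseteq> L (s \<circ> t)"
      unfolding L_def using LIMSEQ_subseq_LIMSEQ[OF _ t] by (fastforce simp: o_assoc)
    then have "span (L s) = span (L (s \<circ> t))"
      using s_max[OF strict_mono_o[OF s t]] by (rule dim_eq_span)
    moreover have "p \<in> L (s \<circ> t)"
      using z p by (auto simp: L_def o_assoc)
    ultimately show ?thesis by (simp add: span_base)
  qed
  \<comment> \<open>The difference of two cluster points is both in \<open>span (L s)\<close> and orthogonal to it.\<close>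
  have "convergent (z \<circ> s)" if z: "z \<in> Z" for z
  proof (rule bounded_convergent_if_unique_cluster_point)
    have "Bseq (\<lambda>n. norm (z n))"
      by (rule convergent_imp_Bseq[OF norm_conv[OF z]])
    then have "bounded (range z)"
      by (auto simp: Bseq_def bounded_iff)
    then show "bounded (range (z \<circ> s))"
      by (rule bounded_subset) auto
  next
    fix t u p q
    assume t: "strict_mono t" "((z \<circ> s) \<circ> t) \<longlonglongrightarrow> p" and u: "strict_mono u" "((z \<circ> s) \<circ> u) \<longlonglongrightarrow> q"
    have norm_eq: "norm p = norm q"
      using LIMSEQ_common_subseq_limits_equal
        [OF norm_conv[OF z] strict_mono_o[OF s t(1)] strict_mono_o[OF s u(1)]]
        tendsto_norm[OF t(2)] tendsto_norm[OF u(2)]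
      by (simp add: o_def)
    have orth: "orthogonal (p - q) v" if v: "v \<in> L s" for v
    proof -
      obtain w where w: "w \<in> Z" "(w \<circ> s) \<longlonglongrightarrow> v"
        using v by (auto simp: L_def)
      have "dist p v = dist q v"
        using LIMSEQ_common_subseq_limits_equal
          [OF dist_conv[OF z w(1)] strict_mono_o[OF s t(1)] strict_mono_o[OF s u(1)]]
          tendsto_dist[OF t(2) LIMSEQ_subseq_LIMSEQ[OF w(2) t(1)]]
          tendsto_dist[OF u(2) LIMSEQ_subseq_LIMSEQ[OF w(2) u(1)]]
        by (simp add: o_def)
      then have "inner (p - v) (p - v) = inner (q - v) (q - v)"
        by (simp add: dist_norm norm_eq_sqrt_inner)
      moreover have "inner p p = inner q q"
        using norm_eq by (simp add: norm_eq_sqrt_inner)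
      ultimately show ?thesis
        by (simp add: orthogonal_def inner_diff_left inner_diff_right inner_commute)
    qed
    have span: "p - q \<in> span (L s)"
      using in_span[OF z t] in_span[OF z u] by (rule span_diff)
    have "orthogonal (p - q) (p - q)"
      by (rule orthogonal_to_span[OF span orth])
    then show "p = q" by (simp add: orthogonal_self)
  qed
  with s show ?thesis by (rule that)
qed

section \<open>Blow-ups\<close>

definition blowup :: "'a::real_normed_vector \<Rightarrow> (nat \<Rightarrow> real) \<Rightarrow> (nat \<Rightarrow> 'a) \<Rightarrow> nat \<Rightarrow> 'a" where
  "blowup a r x n = a + (x n - a) /\<^sub>R r n"

lemma dist_blowup: "r n > 0 \<Longrightarrow> dist (blowup a r x n) (blowup a r y n) = dist (x n) (y n) / r n"
  by (simp add: blowup_def dist_norm divide_inverse_commute flip: scaleR_diff_right)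

lemma blowup_base [simp]: "blowup a r (\<lambda>n. a) = (\<lambda>n. a)"
  by (simp add: blowup_def fun_eq_iff)

lemma blowup_comp: "blowup a (r \<circ> s) (x \<circ> s) = blowup a r x \<circ> s"
  by (simp add: blowup_def fun_eq_iff)

lemma mutually_stable_blowup:
  assumes "\<And>n. r n > 0"
  shows "mutually_stable r x y \<longleftrightarrow> convergent (\<lambda>n. dist (blowup a r x n) (blowup a r y n))"
  using assms by (simp add: mutually_stable_def dist_blowup)

lemma seq_dist_blowup:
  assumes "\<And>n. r n > 0" "blowup a r x \<longlonglongrightarrow> p" "blowup a r y \<longlonglongrightarrow> q"
  shows "seq_dist r x y = dist p q"
  using limI[OF tendsto_dist[OF assms(2,3)]] by (simp add: seq_dist_def dist_blowup assms(1))

definition convergent_blowups ::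
    "'a::real_normed_vector set \<Rightarrow> 'a \<Rightarrow> (nat \<Rightarrow> real) \<Rightarrow> (nat \<Rightarrow> 'a) set" where
  "convergent_blowups Y a r = {x \<in> UNIV \<rightarrow> Y. convergent (blowup a r x)}"

lemma self_stable_convergent_blowups:
  assumes "\<And>n. r n > 0"
  shows "self_stable Y r (convergent_blowups Y a r)"
proof -
  have "mutually_stable r x y" if "convergent (blowup a r x)" "convergent (blowup a r y)" for x y
    using that unfolding mutually_stable_blowup[where r = r and a = a, OF assms]
    by (auto simp: convergent_def intro: tendsto_dist)
  then show ?thesis
    by (auto simp: self_stable_def convergent_blowups_def)
qed

section \<open>The cone as the limit of the magnified set\<close>

text \<open>
  For convex \<open>Y\<close> the rays from \<open>a\<close> through \<open>Y\<close> already form a convex set, so nothing but a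
  closure is needed to reach the smallest closed convex cone; thus every point of the
  cone is approximated by points \<open>a + t (y - a)\<close> with a single \<open>y \<in> Y\<close>.
\<close>
lemma Conv_eq_closure_conic_hull:
  assumes Y: "convex Y" "a \<in> Y"
  shows "Conv a Y = (+) a ` closure (conic hull ((\<lambda>y. y - a) ` Y))" (is "_ = (+) a ` ?K")
proof
  have conic: "conic ?K"
    by (intro conic_closure conic_conic_hull)
  have "convex ((\<lambda>y. y - a) ` Y)"
    using Y by (simp add: convex_translation_subtract)
  then have "convex ((+) a ` ?K)"
    by (intro convex_translation convex_closure convex_conic_hull)
  moreover have "closed ((+) a ` ?K)"
    by (intro closed_translation closed_closure)
  moreover have "cone_with_vertex a ((+) a ` ?K)"
    using conic_mul[OF conic] by (auto simp: cone_with_vertex_def ray_def simp flip: scaleR_conv_of_real)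
  moreover have "y \<in> (+) a ` ?K" if "y \<in> Y" for y
    using that closure_subset hull_inc[of "y - a" "(\<lambda>y. y - a) ` Y" conic]
    by (intro image_eqI[of _ _ "y - a"]) auto
  ultimately show "Conv a Y \<subseteq> (+) a ` ?K"
    unfolding Conv_def by (intro Inter_lower) auto
next
  have "(+) a ` ?K \<subseteq> A"
    if A: "closed A" "cone_with_vertex a A" "Y \<subseteq> A" for A
  proof -
    have "(+) a ` (conic hull ((\<lambda>y. y - a) ` Y)) \<subseteq> A"
      using A(2,3)
      by (fastforce simp: conic_hull_explicit cone_with_vertex_def ray_def scaleR_conv_of_real)
    then have "closure ((+) a ` (conic hull ((\<lambda>y. y - a) ` Y))) \<subseteq> A"
      using A(1) by (rule closure_minimal)
    then show ?thesis by (simp add: closure_translation)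
  qed
  then show "(+) a ` ?K \<subseteq> Conv a Y"
    unfolding Conv_def by blast
qed

lemma closed_Conv: "closed (Conv a Y)"
  unfolding Conv_def by (intro closed_Inter) auto

lemma blowup_in_Conv:
  assumes "x n \<in> Y" "r n > 0"
  shows "blowup a r x n \<in> Conv a Y"
proof -
  have "blowup a r x n \<in> ray a (x n)"
    unfolding ray_def blowup_def using assms(2)
    by (auto intro!: exI[of _ "inverse (r n)"] simp: scaleR_conv_of_real)
  then show ?thesis
    using assms(1) unfolding Conv_def cone_with_vertex_def by blast
qed

lemma limit_blowup_in_Conv:
  assumes "x \<in> UNIV \<rightarrow> Y" "\<And>n. r n > 0" "blowup a r x \<longlonglongrightarrow> p"
  shows "p \<in> Conv a Y"
  by (rule closed_sequentially[OF closed_Conv _ assms(3)])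
     (use assms(1,2) in \<open>auto intro: blowup_in_Conv\<close>)

text \<open>
  A point \<open>a + t (y - a)\<close> of the cone lies in the copy of \<open>Y\<close> magnified by \<open>1 / r n\<close> as soon as
  \<open>t * r n \<le> 1\<close>, by convexity. Such points are dense in the cone, so the distance of \<open>p\<close> to the
  magnified copies tends to \<open>0\<close>, and almost nearest points give the sequence.
\<close>
lemma Conv_point_is_blowup_limit:
  assumes Y: "convex Y" "a \<in> Y" and r: "normalizing_seq r" and p: "p \<in> Conv a Y"
  obtains x where "x \<in> UNIV \<rightarrow> Y" "blowup a r x \<longlonglongrightarrow> p"
proof -
  have r_lim: "r \<longlonglongrightarrow> 0" and r_all: "\<forall>n. r n > 0"
    using r by (auto simp: normalizing_seq_def)
  have r_pos: "r n > 0" for n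
    using r_all by blast
  define S where "S n = (\<lambda>y. a + (y - a) /\<^sub>R r n) ` Y" for n
  have S_ne: "S n \<noteq> {}" for n
    using Y(2) by (auto simp: S_def)
  have "(\<lambda>n. infdist p (S n)) \<longlonglongrightarrow> 0"
  proof (rule tendstoI)
    fix e :: real assume e: "e > 0"
    have "p - a \<in> closure (conic hull ((\<lambda>y. y - a) ` Y))"
      using p unfolding Conv_eq_closure_conic_hull[OF Y] by auto
    then obtain k where k: "k \<in> conic hull ((\<lambda>y. y - a) ` Y)" "dist k (p - a) < e"
      using e unfolding closure_approachable by blast
    then obtain t y where t: "t \<ge> 0" "y \<in> Y" "k = t *\<^sub>R (y - a)"
      by (auto simp: conic_hull_explicit)
    have "(\<lambda>n. t * r n) \<longlonglongrightarrow> 0"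
      using tendsto_mult_left[OF r_lim, of t] by simp
    then have "\<forall>\<^sub>F n in sequentially. t * r n < 1"
      by (rule order_tendstoD) simp
    then show "\<forall>\<^sub>F n in sequentially. dist (infdist p (S n)) 0 < e"
    proof eventually_elim
      case (elim n)
      define y' where "y' = a + (t * r n) *\<^sub>R (y - a)"
      have "y' = (1 - t * r n) *\<^sub>R a + (t * r n) *\<^sub>R y"
        by (simp add: y'_def algebra_simps)
      then have "y' \<in> Y"
        using convexD[OF Y(1) Y(2) t(2), of "1 - t * r n" "t * r n"] t(1) elim r_pos[of n]
        by simp
      moreover have "a + (y' - a) /\<^sub>R r n = a + k"
        using r_pos[of n] by (simp add: y'_def t(3))
      ultimately have "a + k \<in> S n"
        unfolding S_def by (metis image_eqI)
      then have "infdist p (S n) \<le> dist p (a + k)"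
        by (rule infdist_le)
      also have "\<dots> < e"
        using k(2) by (simp add: dist_norm norm_minus_commute algebra_simps)
      finally show ?case by (simp add: infdist_nonneg)
    qed
  qed
  then have bound_lim: "(\<lambda>n. infdist p (S n) + r n) \<longlonglongrightarrow> 0"
    using tendsto_add[OF _ r_lim] by force
  \<comment> \<open>The infimum defining the distance need not be attained, since \<open>Y\<close> need not be closed;
    \<open>r n\<close> is a convenient positive error that vanishes in the limit.\<close>
  have "\<exists>y\<in>Y. dist p (a + (y - a) /\<^sub>R r n) < infdist p (S n) + r n" for n
  proof -
    have "(INF q\<in>S n. dist p q) < infdist p (S n) + r n"
      using S_ne r_pos[of n] by (simp add: infdist_notempty)
    then have "\<exists>q\<in>S n. dist p q < infdist p (S n) + r n"
      using S_ne by (subst (asm) cINF_less_iff) auto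
    then show ?thesis by (auto simp: S_def)
  qed
  then obtain x where x: "\<And>n. x n \<in> Y" "\<And>n. dist p (blowup a r x n) < infdist p (S n) + r n"
    unfolding blowup_def by metis
  have "(\<lambda>n. dist (blowup a r x n) p) \<longlonglongrightarrow> 0"
    by (rule tendsto_sandwich[OF _ _ tendsto_const bound_lim])
       (auto simp: dist_commute x(2) less_imp_le)
  then have "blowup a r x \<longlonglongrightarrow> p"
    by (rule iffD2[OF tendsto_dist_iff])
  with x(1) show ?thesis by (intro that[of x]) auto
qed

text \<open>
  Two cluster points \<open>p\<close>, \<open>q\<close> of the blow-up of \<open>u\<close> are equidistant from the limit of every blow-up
  whose sequence is stable with \<open>u\<close>. Since \<open>p\<close> lies in the cone, it may be taken as that limit.
  Stability is asked for only one sequence per point of the cone; this covers a sequence stable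
  with the subsequences \<open>x \<circ> s\<close> of the members \<open>x\<close> of \<open>convergent_blowups\<close>, the situation
  in the definition of a tangent space.
\<close>
lemma blowup_convergent_if_stable_with_all_limits:
  assumes r: "\<And>n. r n > 0" and a: "a \<in> Y" and u: "u \<in> UNIV \<rightarrow> Y"
    and stable: "\<And>p. p \<in> Conv a Y \<Longrightarrow> \<exists>x. mutually_stable r u x \<and> blowup a r x \<longlonglongrightarrow> p"
  shows "convergent (blowup a r u)"
proof (rule bounded_convergent_if_unique_cluster_point)
  have aC: "a \<in> Conv a Y"
    using a by (auto simp: Conv_def)
  then obtain x where x: "mutually_stable r u x" "blowup a r x \<longlonglongrightarrow> a"
    using stable by blast
  have "bounded (range (\<lambda>n. dist (blowup a r u n) (blowup a r x n)))"
    using x(1) unfolding mutually_stable_blowup[where r = r and a = a, OF r] convergent_def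
    by (auto intro: convergent_imp_bounded)
  then obtain b where b: "\<And>n. dist (blowup a r u n) (blowup a r x n) \<le> b"
    by (auto simp: bounded_iff)
  have "bounded (range (blowup a r x))"
    using x(2) by (rule convergent_imp_bounded)
  then obtain c where c: "\<And>n. dist a (blowup a r x n) \<le> c"
    unfolding bounded_any_center[of _ a] by auto
  have "dist a (blowup a r u n) \<le> b + c" for n
    using dist_triangle3[of a "blowup a r u n" "blowup a r x n"] b[of n] c[of n]
    by (simp add: dist_commute)
  then show "bounded (range (blowup a r u))"
    unfolding bounded_any_center[of _ a] by auto
next
  fix s t p q
  assume s: "strict_mono s" "(blowup a r u \<circ> s) \<longlonglongrightarrow> p"
    and t: "strict_mono t" "(blowup a r u \<circ> t) \<longlonglongrightarrow> q"
  have "p \<in> Conv a Y"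
    by (rule closed_sequentially[OF closed_Conv _ s(2)]) (use u r in \<open>auto intro: blowup_in_Conv\<close>)
  then obtain x where x: "mutually_stable r u x" "blowup a r x \<longlonglongrightarrow> p"
    using stable by blast
  have "dist p p = dist q p"
    using LIMSEQ_common_subseq_limits_equal
        [OF x(1)[unfolded mutually_stable_blowup[where r = r and a = a, OF r]] s(1) t(1)]
      tendsto_dist[OF s(2) LIMSEQ_subseq_LIMSEQ[OF x(2) s(1)]]
      tendsto_dist[OF t(2) LIMSEQ_subseq_LIMSEQ[OF x(2) t(1)]]
    by (simp add: o_def)
  then show "p = q" by simp
qed

section \<open>The tangent space that realizes the cone\<close>

lemma pretangent_family_convergent_blowups:
  fixes Y :: "complex set"
  assumes Y: "convex Y" "a \<in> Y" and r: "normalizing_seq r"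
  shows "pretangent_family Y a r (convergent_blowups Y a r)"
proof -
  have r_pos: "r n > 0" for n
    using r by (auto simp: normalizing_seq_def)
  have "z \<in> convergent_blowups Y a r"
    if z: "z \<in> UNIV \<rightarrow> Y" "\<forall>x\<in>convergent_blowups Y a r. mutually_stable r z x" for z
  proof -
    have "\<exists>x. mutually_stable r z x \<and> blowup a r x \<longlonglongrightarrow> p" if p: "p \<in> Conv a Y" for p
    proof -
      obtain x where x: "x \<in> UNIV \<rightarrow> Y" "blowup a r x \<longlonglongrightarrow> p"
        using Conv_point_is_blowup_limit[OF Y r p] .
      then have "x \<in> convergent_blowups Y a r"
        by (auto simp: convergent_blowups_def convergent_def)
      with z(2) x(2) show ?thesis by blast
    qed
    then show ?thesis
      using blowup_convergent_if_stable_with_all_limits[OF r_pos Y(2) z(1)] z(1)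
      by (simp add: convergent_blowups_def)
  qed
  moreover have "(\<lambda>n. a) \<in> convergent_blowups Y a r"
    using Y(2) by (auto simp: convergent_blowups_def convergent_def intro!: exI[of _ a])
  ultimately show ?thesis
    unfolding pretangent_family_def maximal_self_stable_def
    using self_stable_convergent_blowups[where r = r and Y = Y and a = a, OF r_pos] by blast
qed

lemma normalizing_seq_subseq:
  assumes "normalizing_seq r" "strict_mono s"
  shows "normalizing_seq (r \<circ> s)"
  using assms LIMSEQ_subseq_LIMSEQ by (auto simp: normalizing_seq_def)

lemma pretangent_space_cases:
  assumes "A \<in> pretangent_space r F"
  obtains x where "x \<in> F" "A = zero_dist_rel r F `` {x}"
  using assms by (auto simp: pretangent_space_def quotient_def)

lemma pretangent_spaceI: "x \<in> F \<Longrightarrow> zero_dist_rel r F `` {x} \<in> pretangent_space r F"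
  by (auto simp: pretangent_space_def quotient_def)

text \<open>
  Distances are limits, hence unchanged along a subsequence; the point is surjectivity. A member
  \<open>u\<close> of the larger family is stable with all \<open>x \<circ> s\<close>, whose blow-ups still reach every point of
  the cone. So the blow-up of \<open>u\<close> converges, to a point that is also the limit of some \<open>x \<circ> s\<close>,
  which is therefore at distance \<open>0\<close> from \<open>u\<close>.
\<close>
lemma tangent_convergent_blowups:
  fixes Y :: "complex set"
  assumes Y: "convex Y" "a \<in> Y" and r: "normalizing_seq r"
  shows "tangent Y a r (convergent_blowups Y a r)" (is "tangent Y a r ?B")
  unfolding tangent_def
proof (intro conjI allI impI)
  show "pretangent_family Y a r ?B"
    by (rule pretangent_family_convergent_blowups[OF assms])
  fix s F'
  assume "strict_mono s \<and> pretangent_family Y a (r \<circ> s) F' \<and> subseq_family s ?B \<subseteq> F'"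
  then have s: "strict_mono s" and F': "self_stable Y (r \<circ> s) F'" and sub: "subseq_family s ?B \<subseteq> F'"
    by (auto simp: pretangent_family_def maximal_self_stable_def)
  have r_pos: "r n > 0" and rs_pos: "(r \<circ> s) n > 0" for n
    using r by (auto simp: normalizing_seq_def)
  note B = self_stable_convergent_blowups[where r = r and Y = Y and a = a, OF r_pos]
  have map_class: "subseq_map r s F' (zero_dist_rel r ?B `` {x}) = zero_dist_rel (r \<circ> s) F' `` {x \<circ> s}"
    if "x \<in> ?B" for x
    by (rule subseq_map_class[OF r_pos B s F' sub that])
  have mem: "x \<circ> s \<in> F'" if "x \<in> ?B" for x
    using that sub by (auto simp: subseq_family_def)
  have surj: "\<exists>x\<in>?B. zero_dist_rel (r \<circ> s) F' `` {x \<circ> s} = zero_dist_rel (r \<circ> s) F' `` {u}"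
    if u: "u \<in> F'" for u
  proof -
    have limit: "\<exists>x\<in>?B. mutually_stable (r \<circ> s) u (x \<circ> s) \<and> blowup a (r \<circ> s) (x \<circ> s) \<longlonglongrightarrow> p"
      if p: "p \<in> Conv a Y" for p
    proof -
      obtain x where x: "x \<in> UNIV \<rightarrow> Y" "blowup a r x \<longlonglongrightarrow> p"
        using Conv_point_is_blowup_limit[OF Y r p] .
      then have "x \<in> ?B" by (auto simp: convergent_blowups_def convergent_def)
      moreover have "blowup a (r \<circ> s) (x \<circ> s) \<longlonglongrightarrow> p"
        unfolding blowup_comp by (rule LIMSEQ_subseq_LIMSEQ[OF x(2) s])
      moreover have "mutually_stable (r \<circ> s) u (x \<circ> s)"
        using F' u mem[OF \<open>x \<in> ?B\<close>] by (auto simp: self_stable_def)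
      ultimately show ?thesis by blast
    qed
    have uY: "u \<in> UNIV \<rightarrow> Y"
      using F' u by (auto simp: self_stable_def)
    have "convergent (blowup a (r \<circ> s) u)"
      using limit by (intro blowup_convergent_if_stable_with_all_limits[OF rs_pos Y(2) uY]) blast
    then obtain p where p: "blowup a (r \<circ> s) u \<longlonglongrightarrow> p"
      by (auto simp: convergent_def)
    then have "p \<in> Conv a Y"
      by (rule limit_blowup_in_Conv[OF uY rs_pos])
    then obtain x where x: "x \<in> ?B" "blowup a (r \<circ> s) (x \<circ> s) \<longlonglongrightarrow> p"
      using limit by blast
    have zero: "seq_dist (r \<circ> s) (x \<circ> s) u = 0" "seq_dist (r \<circ> s) u (x \<circ> s) = 0"
      using seq_dist_blowup[OF rs_pos x(2) p] seq_dist_blowup[OF rs_pos p x(2)] by simp_all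
    have "seq_dist (r \<circ> s) (x \<circ> s) w = seq_dist (r \<circ> s) u w" if w: "w \<in> F'" for w
    proof -
      have stable: "mutually_stable (r \<circ> s) v v'" if "v \<in> F'" "v' \<in> F'" for v v'
        using F' that by (auto simp: self_stable_def)
      note xF = mem[OF x(1)]
      show ?thesis
        using seq_dist_triangle[OF rs_pos stable[OF xF u] stable[OF u w] stable[OF xF w]]
          seq_dist_triangle[OF rs_pos stable[OF u xF] stable[OF xF w] stable[OF u w]] zero
        by linarith
    qed
    then have "zero_dist_rel (r \<circ> s) F' `` {x \<circ> s} = zero_dist_rel (r \<circ> s) F' `` {u}"
      using mem[OF x(1)] u by (auto simp: zero_dist_rel_def)
    with x(1) show ?thesis by blast
  qed
  show "is_isometry (pretangent_space r ?B) (pretangent_dist r)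
          (pretangent_space (r \<circ> s) F') (pretangent_dist (r \<circ> s)) (subseq_map r s F')"
    unfolding is_isometry_def
  proof (intro conjI ballI set_eqI iffI)
    fix A assume "A \<in> subseq_map r s F' ` pretangent_space r ?B"
    then show "A \<in> pretangent_space (r \<circ> s) F'"
      using map_class mem by (auto elim!: pretangent_space_cases intro!: pretangent_spaceI)
  next
    fix A assume "A \<in> pretangent_space (r \<circ> s) F'"
    then obtain u where "u \<in> F'" "A = zero_dist_rel (r \<circ> s) F' `` {u}"
      by (rule pretangent_space_cases)
    then obtain x where "x \<in> ?B" "A = zero_dist_rel (r \<circ> s) F' `` {x \<circ> s}"
      using surj by metis
    then show "A \<in> subseq_map r s F' ` pretangent_space r ?B"
      using map_class by (intro image_eqI[OF _ pretangent_spaceI]) auto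
  next
    fix A A' assume "A \<in> pretangent_space r ?B" "A' \<in> pretangent_space r ?B"
    then obtain x y where xy: "x \<in> ?B" "y \<in> ?B"
      and A: "A = zero_dist_rel r ?B `` {x}" "A' = zero_dist_rel r ?B `` {y}"
      by (elim pretangent_space_cases) blast
    obtain p q where pq: "blowup a r x \<longlonglongrightarrow> p" "blowup a r y \<longlonglongrightarrow> q"
      using xy by (auto simp: convergent_blowups_def convergent_def)
    have "seq_dist (r \<circ> s) (x \<circ> s) (y \<circ> s) = dist p q"
      by (rule seq_dist_blowup[OF rs_pos, of a]) (simp_all only: blowup_comp LIMSEQ_subseq_LIMSEQ[OF _ s] pq)
    also have "\<dots> = seq_dist r x y"
      by (rule seq_dist_blowup[OF r_pos pq, symmetric])
    finally show "pretangent_dist (r \<circ> s) (subseq_map r s F' A) (subseq_map r s F' A') = pretangent_dist r A A'"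
      by (simp add: A map_class xy pretangent_dist_class[OF r_pos B] mem
          pretangent_dist_class[OF rs_pos F'])
  qed
qed

text \<open>
  The limit of the blow-up is constant on classes and turns \<open>seq_dist\<close> into the distance of the
  plane. It is onto because every point of the cone is such a limit.
\<close>
lemma pretangent_space_convergent_blowups_isometric:
  fixes Y :: "complex set"
  assumes Y: "convex Y" "a \<in> Y" and r: "normalizing_seq r"
  shows "isometric_spaces (pretangent_space r (convergent_blowups Y a r)) (pretangent_dist r) (Conv a Y) dist"
    (is "isometric_spaces (pretangent_space r ?B) _ _ _")
proof -
  have r_pos: "r n > 0" for n
    using r by (auto simp: normalizing_seq_def)
  note B = self_stable_convergent_blowups[where r = r and Y = Y and a = a, OF r_pos]
  define f where "f A = lim (blowup a r (SOME x. x \<in> A))" for A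
  have f: "f (zero_dist_rel r ?B `` {x}) = p" if x: "x \<in> ?B" "blowup a r x \<longlonglongrightarrow> p" for x p
  proof -
    define x' where "x' = (SOME x'. x' \<in> zero_dist_rel r ?B `` {x})"
    have "x \<in> zero_dist_rel r ?B `` {x}"
      using x(1) by (simp add: zero_dist_rel_def seq_dist_refl)
    then have "x' \<in> zero_dist_rel r ?B `` {x}"
      unfolding x'_def by (subst some_in_eq) blast
    then have x': "x' \<in> ?B" "seq_dist r x x' = 0"
      by (auto simp: zero_dist_rel_def)
    then obtain q where q: "blowup a r x' \<longlonglongrightarrow> q"
      by (auto simp: convergent_blowups_def convergent_def)
    then have "p = q"
      using seq_dist_blowup[OF r_pos x(2) q] x'(2) by simp
    then show ?thesis
      using limI[OF q] by (simp add: f_def x'_def)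
  qed
  have "is_isometry (pretangent_space r ?B) (pretangent_dist r) (Conv a Y) dist f"
    unfolding is_isometry_def
  proof (intro conjI ballI set_eqI iffI)
    fix p assume "p \<in> f ` pretangent_space r ?B"
    then obtain x where x: "x \<in> ?B" "p = f (zero_dist_rel r ?B `` {x})"
      by (auto elim: pretangent_space_cases)
    then obtain q where "blowup a r x \<longlonglongrightarrow> q"
      by (auto simp: convergent_blowups_def convergent_def)
    with x show "p \<in> Conv a Y"
      using f limit_blowup_in_Conv[OF _ r_pos] by (auto simp: convergent_blowups_def)
  next
    fix p assume p: "p \<in> Conv a Y"
    obtain x where x: "x \<in> UNIV \<rightarrow> Y" "blowup a r x \<longlonglongrightarrow> p"
      using Conv_point_is_blowup_limit[OF Y r p] .
    then have "x \<in> ?B" by (auto simp: convergent_blowups_def convergent_def)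
    then show "p \<in> f ` pretangent_space r ?B"
      using f x(2) by (intro image_eqI[OF _ pretangent_spaceI]) auto
  next
    fix A A' assume "A \<in> pretangent_space r ?B" "A' \<in> pretangent_space r ?B"
    then obtain x y where xy: "x \<in> ?B" "y \<in> ?B"
      and A: "A = zero_dist_rel r ?B `` {x}" "A' = zero_dist_rel r ?B `` {y}"
      by (elim pretangent_space_cases) blast
    obtain p q where pq: "blowup a r x \<longlonglongrightarrow> p" "blowup a r y \<longlonglongrightarrow> q"
      using xy by (auto simp: convergent_blowups_def convergent_def)
    show "dist (f A) (f A') = pretangent_dist r A A'"
      using f[OF xy(1) pq(1)] f[OF xy(2) pq(2)] seq_dist_blowup[OF r_pos pq]
      by (simp add: A pretangent_dist_class[OF r_pos B] xy)
  qed
  then show ?thesis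
    by (auto simp: isometric_spaces_def)
qed

section \<open>Arbitrary pretangent spaces\<close>

lemma is_isometry_compose:
  assumes "is_isometry M d N e f" "is_isometry N e P h g"
  shows "is_isometry M d P h (g \<circ> f)"
  using assms by (auto simp: is_isometry_def image_comp[symmetric])

text \<open>
  Stability with the constant sequence \<open>a\<close> makes the distances of the blow-ups to \<open>a\<close> converge,
  so after translating \<open>a\<close> to the origin the norms converge as well.
\<close>
lemma pretangent_family_subseq_convergent_blowups:
  fixes Y :: "'a::euclidean_space set"
  assumes r: "\<And>n. r n > 0" and F: "pretangent_family Y a r F"
  obtains s where "strict_mono s" "subseq_family s F \<subseteq> convergent_blowups Y a (r \<circ> s)"
proof -
  have FY: "x \<in> UNIV \<rightarrow> Y" and stable: "\<And>y. y \<in> F \<Longrightarrow> mutually_stable r x y"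
    if "x \<in> F" for x
    using F that by (auto simp: pretangent_family_def maximal_self_stable_def self_stable_def)
  have aF: "(\<lambda>n. a) \<in> F"
    using F by (simp add: pretangent_family_def)
  define Z where "Z = (\<lambda>x n. blowup a r x n - a) ` F"
  have dist_conv: "convergent (\<lambda>n. dist (z n) (w n))" if "z \<in> Z" "w \<in> Z" for z w
    using that stable by (auto simp: Z_def mutually_stable_blowup[where r = r and a = a, OF r] dist_norm)
  moreover have "(\<lambda>n. 0) \<in> Z"
    using aF by (force simp: Z_def)
  ultimately have "convergent (\<lambda>n. norm (z n))" if "z \<in> Z" for z
    using that by fastforce
  from common_convergent_subsequence[OF this dist_conv]
  obtain s :: "nat \<Rightarrow> nat" where s: "strict_mono s" and conv: "\<And>z. z \<in> Z \<Longrightarrow> convergent (z \<circ> s)"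
    by blast
  have "x \<circ> s \<in> convergent_blowups Y a (r \<circ> s)" if x: "x \<in> F" for x
  proof -
    have "convergent ((\<lambda>n. blowup a r x n - a) \<circ> s)"
      using conv x by (auto simp: Z_def)
    then have "convergent (\<lambda>n. (blowup a r x (s n) - a) + a)"
      by (simp only: o_def convergent_add_const_right_iff)
    then have "convergent (blowup a r x \<circ> s)"
      by (simp add: o_def)
    then show ?thesis
      using FY[OF x] by (auto simp: convergent_blowups_def blowup_comp)
  qed
  then show ?thesis
    using s by (intro that[of s]) (auto simp: subseq_family_def)
qed

theorem corollary1p11:
  fixes Y :: "complex set" and a :: complex and r :: "nat \<Rightarrow> real"
    and F :: "(nat \<Rightarrow> complex) set"
  assumes "convex Y" and "a \<in> Y" and "normalizing_seq r"
    and "pretangent_family Y a r F"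
  shows "(tangent Y a r F \<longrightarrow>
            isometric_spaces (pretangent_space r F) (pretangent_dist r) (Conv a Y) dist)
         \<and> lies_in_tangent Y a r F"
proof -
  have "\<And>n. r n > 0"
    using assms(3) by (simp add: normalizing_seq_def)
  then obtain s where s: "strict_mono s" and sub: "subseq_family s F \<subseteq> convergent_blowups Y a (r \<circ> s)"
    using pretangent_family_subseq_convergent_blowups[OF _ assms(4)] by blast
  note rs = normalizing_seq_subseq[OF assms(3) s]
  note fam = pretangent_family_convergent_blowups[OF assms(1,2) rs]
  have "lies_in_tangent Y a r F"
    unfolding lies_in_tangent_def
    using s sub fam tangent_convergent_blowups[OF assms(1,2) rs] by blast
  moreover have "isometric_spaces (pretangent_space r F) (pretangent_dist r) (Conv a Y) dist"
    if "tangent Y a r F"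
  proof -
    have "is_isometry (pretangent_space r F) (pretangent_dist r)
        (pretangent_space (r \<circ> s) (convergent_blowups Y a (r \<circ> s))) (pretangent_dist (r \<circ> s))
        (subseq_map r s (convergent_blowups Y a (r \<circ> s)))"
      using that s sub fam unfolding tangent_def by blast
    then show ?thesis
      using pretangent_space_convergent_blowups_isometric[OF assms(1,2) rs] is_isometry_compose
      unfolding isometric_spaces_def by blast
  qed
  ultimately show ?thesis by blast
qed

end
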